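(* Let $n\ge 4$ and let $\mathcal{R}\subseteq 2^{[2n]}$ be a restrictive collection. Then $\mathcal{R}$ does not contain a copy of $2^{[n]}$, i.e. there is no poset embedding $f:2^{[n]}\to 2^{[2n]}$ whose image is contained in $\mathcal{R}$.
   Context: Partition $[2n]$ into the $n$ pairs $\{1,2\},\{3,4\},\dots,\{2n-1,2n\}$ (so $a,b$ are in the same pair iff $\lceil a/2\rceil=\lceil b/2\rceil$). A set $S\subseteq[2n]$ has a pair if it contains both elements of that pair, and misses the pair if it contains neither element. A collection $\mathcal{R}\subseteq 2^{[2n]}$ is restrictive if all of the following hold: (i) (pair-enforcing) every $S\in\mathcal{R}$ with $\lceil n/2\rceil\le |S|<n$ has at least one pair; (ii) (miss-forbidding) every $S\in\mathcal{R}$ with $n<|S|\le n+\lfloor n/2\rfloor$ misses no pair; (iii) (not-too-high) every $S\in\mathcal{R}$ satisfies $|S|\le n+\lfloor n/2\rfloor$; (iv) (flip-susceptible) whenever $S_1,S_2\subseteq[2n]$ satisfy $|S_1|=|S_2|=n$, $|S_1\cup S_2|=n+1$, and neither $S_1$ nor $S_2$ has any pair, at most one of $S_1,S_2$ lies in $\mathcal{R}$. A poset embedding $f:2^{[n]}\to 2^{[2n]}$ is an injective map with $S\subseteq T\iff f(S)\subseteq f(T)$; its image is a copy of $2^{[n]}$. *)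

theory Defs
  imports Main
begin

(* For i in {1..n} these are the n blocks {1,2}, {3,4}, ..., {2n-1,2n} of {1..2*n}. *)
definition pair_block :: "nat \<Rightarrow> nat set" where
  "pair_block i = {2 * i - 1, 2 * i}"

definition has_pair :: "nat \<Rightarrow> nat set \<Rightarrow> bool" where
  "has_pair n S \<longleftrightarrow> (\<exists>i\<in>{1..n}. pair_block i \<subseteq> S)"

definition misses_pair :: "nat \<Rightarrow> nat set \<Rightarrow> bool" where
  "misses_pair n S \<longleftrightarrow> (\<exists>i\<in>{1..n}. pair_block i \<inter> S = {})"

(* (n + 1) div 2 is the ceiling of n/2, and n div 2 is its floor. *)
definition pair_enforcing :: "nat \<Rightarrow> nat set set \<Rightarrow> bool" where
  "pair_enforcing n R \<longleftrightarrow>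
     (\<forall>S\<in>R. (n + 1) div 2 \<le> card S \<and> card S < n \<longrightarrow> has_pair n S)"

definition miss_forbidding :: "nat \<Rightarrow> nat set set \<Rightarrow> bool" where
  "miss_forbidding n R \<longleftrightarrow>
     (\<forall>S\<in>R. n < card S \<and> card S \<le> n + n div 2 \<longrightarrow> \<not> misses_pair n S)"

definition not_too_high :: "nat \<Rightarrow> nat set set \<Rightarrow> bool" where
  "not_too_high n R \<longleftrightarrow> (\<forall>S\<in>R. card S \<le> n + n div 2)"

definition flip_susceptible :: "nat \<Rightarrow> nat set set \<Rightarrow> bool" where
  "flip_susceptible n R \<longleftrightarrow>
     (\<forall>S1 S2. S1 \<subseteq> {1..2 * n} \<and> S2 \<subseteq> {1..2 * n} \<and>
        card S1 = n \<and> card S2 = n \<and> card (S1 \<union> S2) = n + 1 \<and>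
        \<not> has_pair n S1 \<and> \<not> has_pair n S2 \<longrightarrow>
        \<not> (S1 \<in> R \<and> S2 \<in> R))"

definition restrictive :: "nat \<Rightarrow> nat set set \<Rightarrow> bool" where
  "restrictive n R \<longleftrightarrow>
     R \<subseteq> Pow {1..2 * n} \<and>
     pair_enforcing n R \<and> miss_forbidding n R \<and> not_too_high n R \<and> flip_susceptible n R"

(* Only the values of f on Pow {1..n} matter. *)
definition poset_embedding :: "nat \<Rightarrow> (nat set \<Rightarrow> nat set) \<Rightarrow> bool" where
  "poset_embedding n f \<longleftrightarrow>
     f ` Pow {1..n} \<subseteq> Pow {1..2 * n} \<and>
     inj_on f (Pow {1..n}) \<and>
     (\<forall>S\<in>Pow {1..n}. \<forall>T\<in>Pow {1..n}. S \<subseteq> T \<longleftrightarrow> f S \<subseteq> f T)"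

definition contains_copy :: "nat \<Rightarrow> nat set set \<Rightarrow> bool" where
  "contains_copy n R \<longleftrightarrow> (\<exists>f. poset_embedding n f \<and> f ` Pow {1..n} \<subseteq> R)"

end

theory Submission
  imports Defs
begin

text \<open>
  Choosing \<open>x\<^sub>i \<in> f {i} - f ([n] - {i})\<close> gives \<open>n\<close> distinct points with
  \<open>x\<^sub>i \<in> f A \<longleftrightarrow> i \<in> A\<close>. After identifying \<open>i\<close> with \<open>x\<^sub>i\<close>, a copy of the cube is therefore a
  monotone map \<open>F\<close> on the subsets of an \<open>n\<close>-set \<open>X\<close> with \<open>F A \<inter> X = A\<close>, and all further points lie
  in \<open>Y = F X - X\<close>, which has at most \<open>\<lfloor>n/2\<rfloor>\<close> elements. Writing \<open>K\<close> for the set of pairs that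
  meet \<open>Y\<close>, a set \<open>T \<subseteq> X\<close> with one point in each pair outside \<open>K\<close> has at least \<open>\<lceil>n/2\<rceil>\<close> elements.
  If \<open>Y\<close> contains no pair, then neither does \<open>F T\<close>, which forces \<open>F T = T \<union> Y\<close>; if moreover \<open>X\<close>
  contains a pair, then exchanging its two points in \<open>T\<close> contradicts flip-susceptibility. In the
  remaining cases some \<open>i \<in> X\<close> is the only point of \<open>X \<union> Y\<close> in its pair. Then \<open>F (X - {i})\<close>
  misses a pair, so it has at most one point in \<open>Y\<close>, and some \<open>A \<subseteq> X - {i}\<close> of size at least
  \<open>\<lceil>n/2\<rceil>\<close> has an image of size less than \<open>n\<close> without a pair.
\<close>

section \<open>Pairs as fibres of a map\<close>

definition blk :: "nat \<Rightarrow> nat" where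
  "blk v = (v + 1) div 2"

lemma blk_range: "S \<subseteq> {1..2 * n} \<Longrightarrow> blk ` S \<subseteq> {1..n}"
  by (force simp: blk_def)

lemma blk_eq_iff: "1 \<le> i \<Longrightarrow> blk v = i \<longleftrightarrow> v \<in> pair_block i"
  by (auto simp: blk_def pair_block_def)

lemma blk_three: "blk u = blk v \<Longrightarrow> blk v = blk w \<Longrightarrow> u = v \<or> v = w \<or> u = w"
proof -
  have "a = 2 * blk a - 1 \<or> a = 2 * blk a" for a
    unfolding blk_def by presburger
  then show "blk u = blk v \<Longrightarrow> blk v = blk w \<Longrightarrow> u = v \<or> v = w \<or> u = w"
    by metis
qed

text \<open>On positive integers the fibres of \<open>blk\<close> are the pairs, so being pair-free
  becomes injectivity, which passes to subsets and combines over unions.\<close>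

lemma has_pair_iff_not_inj_on:
  assumes "S \<subseteq> {1..2 * n}"
  shows "has_pair n S \<longleftrightarrow> \<not> inj_on blk S"
proof
  assume "has_pair n S"
  then obtain i where i: "i \<in> {1..n}" "pair_block i \<subseteq> S"
    by (auto simp: has_pair_def)
  then have "blk (2 * i - 1) = blk (2 * i)" "2 * i - 1 \<in> S" "2 * i \<in> S" "2 * i - 1 \<noteq> 2 * i"
    by (auto simp: blk_def pair_block_def)
  then show "\<not> inj_on blk S"
    by (meson inj_onD)
next
  assume "\<not> inj_on blk S"
  then obtain u v where uv: "u \<in> S" "v \<in> S" "blk u = blk v" "u \<noteq> v"
    by (auto simp: inj_on_def)
  have i: "blk u \<in> {1..n}"
    using uv(1) blk_range[OF assms] by blast
  have "u \<in> pair_block (blk u)" "v \<in> pair_block (blk u)"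
    using i blk_eq_iff[of "blk u" u] blk_eq_iff[of "blk u" v] uv(3) by simp_all
  then have "pair_block (blk u) \<subseteq> S"
    using uv by (auto simp: pair_block_def)
  then show "has_pair n S"
    using i by (auto simp: has_pair_def)
qed

lemma misses_pair_iff_image:
  assumes "S \<subseteq> {1..2 * n}"
  shows "misses_pair n S \<longleftrightarrow> blk ` S \<noteq> {1..n}"
proof -
  have "pair_block i \<inter> S = {} \<longleftrightarrow> i \<notin> blk ` S" if "i \<in> {1..n}" for i
    using that by (auto simp flip: blk_eq_iff)
  then show ?thesis
    using blk_range[OF assms] by (auto simp: misses_pair_def)
qed

lemma card_le_twice_card_blk:
  assumes "finite S"
  shows "card S \<le> 2 * card (blk ` S)"
proof -
  have "card {v \<in> S. blk v = i} \<le> 2" for i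
  proof -
    have "{v \<in> S. blk v = i} \<subseteq> {2 * i - 1, 2 * i}"
      by (auto simp: blk_def)
    then have "card {v \<in> S. blk v = i} \<le> card {2 * i - 1, 2 * i}"
      by (intro card_mono) auto
    also have "\<dots> \<le> 2"
      by (simp add: card_insert_if)
    finally show ?thesis .
  qed
  then have "(\<Sum>i\<in>blk ` S. card {v \<in> S. blk v = i}) \<le> (\<Sum>i\<in>blk ` S. 2)"
    by (intro sum_mono)
  moreover have "card S = (\<Sum>i\<in>blk ` S. card {v \<in> S. blk v = i})"
    using sum.image_gen[OF assms, of "\<lambda>_. 1 :: nat" blk] by simp
  ultimately show ?thesis by simp
qed

lemma card_le_one_subset_singleton:
  assumes "finite G" "card G \<le> 1"
  obtains z where "G \<subseteq> {z}"
proof (cases "G = {}")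
  case False
  with assms have "card G = 1"
    by (metis card_0_eq le_antisym less_one not_le)
  then show ?thesis
    using that by (metis card_1_singletonE order_refl)
qed (use that in auto)

section \<open>Normalised copies of the cube and their impossibility\<close>

locale restricted_lift =
  fixes n :: nat and R :: "nat set set" and X :: "nat set" and F :: "nat set \<Rightarrow> nat set"
  assumes n4: "n \<ge> 4"
    and restrictive: "restrictive n R"
    and X_sub: "X \<subseteq> {1..2 * n}"
    and card_X: "card X = n"
    and F_in: "A \<subseteq> X \<Longrightarrow> F A \<in> R"
    and F_mono: "A \<subseteq> B \<Longrightarrow> B \<subseteq> X \<Longrightarrow> F A \<subseteq> F B"
    and F_Int: "A \<subseteq> X \<Longrightarrow> F A \<inter> X = A"
begin

definition Y :: "nat set" where "Y = F X - X"

lemma F_range: "A \<subseteq> X \<Longrightarrow> F A \<subseteq> {1..2 * n}"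
  using F_in restrictive by (auto simp: restrictive_def)

lemma finite_X [simp]: "finite X"
  using X_sub finite_subset by blast

lemma finite_sub: "A \<subseteq> X \<Longrightarrow> finite A"
  by (rule finite_subset[OF _ finite_X])

lemma finite_F: "A \<subseteq> X \<Longrightarrow> finite (F A)"
  using F_range finite_subset by blast

lemma finite_Y [simp]: "finite Y"
  using finite_F by (auto simp: Y_def)

lemma F_X: "F X = X \<union> Y"
  using F_Int[of X] by (auto simp: Y_def)

lemma disjoint_X_Y: "X \<inter> Y = {}"
  by (auto simp: Y_def)

lemma F_upper: "A \<subseteq> X \<Longrightarrow> F A \<subseteq> A \<union> Y"
  using F_mono[of A X] F_Int[of A] F_X by blast

lemma F_lower: "A \<subseteq> X \<Longrightarrow> A \<subseteq> F A"
  using F_Int[of A] by blast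

lemma card_Y: "card Y \<le> n div 2"
proof -
  have "card (F X) \<le> n + n div 2"
    using restrictive F_in[of X] by (auto simp: restrictive_def not_too_high_def)
  then show ?thesis
    by (simp add: F_X card_Un_disjoint disjoint_X_Y card_X)
qed

text \<open>Pair-enforcing read contrapositively; the lower size bound passes from \<open>A\<close>
  to \<open>F A\<close> because \<open>F A\<close> contains \<open>A\<close>.\<close>

lemma inj_F_card_ge:
  assumes "A \<subseteq> X" "(n + 1) div 2 \<le> card A" "inj_on blk (F A)"
  shows "n \<le> card (F A)"
proof (rule ccontr)
  assume "\<not> n \<le> card (F A)"
  moreover have "card A \<le> card (F A)"
    using assms(1) by (intro card_mono finite_F F_lower)
  ultimately have "has_pair n (F A)"
    using restrictive F_in[of A] assms(1,2) by (auto simp: restrictive_def pair_enforcing_def)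
  then show False
    using has_pair_iff_not_inj_on[OF F_range[OF assms(1)]] assms(3) by simp
qed

lemma large_F_blk:
  assumes "A \<subseteq> X" "n < card (F A)"
  shows "blk ` F A = {1..n}"
proof -
  have "card (F A) \<le> n + n div 2"
    using restrictive F_in[of A] assms by (auto simp: restrictive_def not_too_high_def)
  then have "\<not> misses_pair n (F A)"
    using restrictive F_in[of A] assms by (auto simp: restrictive_def miss_forbidding_def)
  then show ?thesis
    using misses_pair_iff_image[OF F_range[OF assms(1)]] by simp
qed

lemma no_flip:
  assumes "S \<in> R" "S' \<in> R" "card (S \<union> S') = n + 1" "card S = n" "card S' = n"
    and "inj_on blk S" "inj_on blk S'"
  shows False
proof -
  have "S \<subseteq> {1..2 * n}" "S' \<subseteq> {1..2 * n}" "flip_susceptible n R"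
    using restrictive assms(1,2) by (auto simp: restrictive_def)
  moreover from this have "\<not> has_pair n S" "\<not> has_pair n S'"
    using assms(6,7) has_pair_iff_not_inj_on by blast+
  ultimately show False
    using assms(1-5) by (simp add: flip_susceptible_def)
qed

text \<open>If \<open>Y\<close> were empty, \<open>F\<close> would fix every subset of
  \<open>X\<close>, and some subset is pair-free of a size that pair-enforcing forbids.\<close>

lemma Y_nonempty: "Y \<noteq> {}"
proof
  assume "Y = {}"
  then have F_eq: "F A = A" if "A \<subseteq> X" for A
    using F_upper[OF that] F_lower[OF that] by blast
  show False
  proof (cases "inj_on blk X")
    case True
    obtain x where x: "x \<in> X"
      using card_X n4 by fastforce
    have "n \<le> card (F (X - {x}))"
      using True x n4 by (intro inj_F_card_ge) (auto simp: F_eq card_X intro: inj_on_subset)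
    then show False
      using x n4 by (simp add: F_eq card_X)
  next
    case False
    \<comment> \<open>One point from each pair met by \<open>X\<close>: at least n/2 points since
      pairs have two elements, fewer than n since \<open>X\<close> contains a pair.\<close>
    obtain T where T: "T \<subseteq> X" "inj_on blk T" "blk ` X = blk ` T"
      using subset_image_inj[of "blk ` X" blk X] by auto
    have "card T = card (blk ` X)"
      using T by (simp add: card_image)
    moreover have "card (blk ` X) < card X"
      using False card_image_le[of X blk] eq_card_imp_inj_on[of X blk] by fastforce
    moreover have "card X \<le> 2 * card (blk ` X)"
      by (simp add: card_le_twice_card_blk)
    moreover have "n \<le> card (F T)" if "(n + 1) div 2 \<le> card T"
      using T that by (intro inj_F_card_ge) (auto simp: F_eq)
    ultimately show False
      using F_eq[OF T(1)] card_X by simp linarith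
  qed
qed

lemma blk_X_Y: "blk ` X \<union> blk ` Y = {1..n}"
proof -
  have "card (F X) = n + card Y"
    by (simp add: F_X card_Un_disjoint disjoint_X_Y card_X)
  moreover have "card Y > 0"
    using Y_nonempty by (simp add: card_gt_0_iff)
  ultimately show ?thesis
    using large_F_blk[of X] by (simp add: F_X image_Un)
qed

lemma card_blk_Y: "card (blk ` Y) \<le> card Y"
  by (simp add: card_image_le)

lemma card_blk_complement: "card ({1..n} - blk ` Y) = n - card (blk ` Y)"
  using blk_X_Y by (subst card_Diff_subset) auto

text \<open>\<open>F (X - {i})\<close> misses the pair of \<open>i\<close>, so miss-forbidding caps
  its size at n. Since \<open>X - {i}\<close> takes up n - 1, at most one point of \<open>Y\<close>
  is left, and monotonicity passes this down to all \<open>A\<close>.\<close>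

lemma lonely_point:
  assumes "i \<in> X" "\<And>v. v \<in> X \<union> Y \<Longrightarrow> blk v = blk i \<Longrightarrow> v = i"
  obtains z where "\<And>A. A \<subseteq> X - {i} \<Longrightarrow> F A \<subseteq> A \<union> (Y \<inter> {z})"
proof -
  let ?B = "X - {i}"
  have upper: "F ?B \<subseteq> ?B \<union> Y"
    by (rule F_upper) auto
  have "blk i \<notin> blk ` F ?B"
  proof
    assume "blk i \<in> blk ` F ?B"
    then obtain v where v: "v \<in> F ?B" "blk v = blk i"
      by auto
    then have "v = i"
      using assms(2)[of v] upper by auto
    then show False
      using v(1) F_Int[of ?B] assms(1) by blast
  qed
  moreover have "blk i \<in> {1..n}"
    using assms(1) blk_X_Y by blast
  ultimately have "\<not> n < card (F ?B)"
    using large_F_blk[of ?B] by auto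
  moreover have "card (F ?B) = card ?B + card (Y \<inter> F ?B)"
  proof -
    have "F ?B = ?B \<union> (Y \<inter> F ?B)"
      using F_lower[of ?B] upper by blast
    then have "card (F ?B) = card (?B \<union> (Y \<inter> F ?B))"
      by (rule arg_cong)
    also have "\<dots> = card ?B + card (Y \<inter> F ?B)"
      using disjoint_X_Y by (intro card_Un_disjoint) auto
    finally show ?thesis .
  qed
  ultimately have "card (Y \<inter> F ?B) \<le> 1"
    using assms(1) n4 by (simp add: card_X)
  then obtain z where z: "Y \<inter> F ?B \<subseteq> {z}"
    by (rule card_le_one_subset_singleton[rotated]) auto
  have "F A \<subseteq> A \<union> (Y \<inter> {z})" if A: "A \<subseteq> X - {i}" for A
    using F_upper[of A] F_mono[OF A] A z by blast
  then show ?thesis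
    by (rule that)
qed

text \<open>\<open>F A\<close> adds at most \<open>z\<close>, which lies in a fresh pair, so it is
  pair-free with fewer than n points.\<close>

lemma lonely_point_contradiction:
  assumes "A \<subseteq> X" "F A \<subseteq> A \<union> (Y \<inter> {z})" "inj_on blk A" "blk z \<notin> blk ` A"
    and "(n + 1) div 2 \<le> card A" "card A + 1 < n"
  shows False
proof -
  have "finite A"
    using assms(1) by (rule finite_sub)
  then have "card (F A) \<le> card (insert z A)"
    using assms(2) by (intro card_mono) auto
  also have "\<dots> \<le> card A + 1"
    using \<open>finite A\<close> by (simp add: card_insert_if)
  finally have "card (F A) < n"
    using assms(6) by simp
  moreover have "inj_on blk (insert z A)"
    using assms(3,4) by auto
  then have "inj_on blk (F A)"
    by (rule inj_on_subset) (use assms(2) in auto)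
  ultimately show False
    using inj_F_card_ge[of A] assms by simp
qed

text \<open>\<open>T \<union> Y\<close> has exactly one point in each pair, so its subset
  \<open>F T\<close> is pair-free; pair-enforcing then leaves room only for equality.\<close>

lemma F_transversal:
  assumes "inj_on blk Y" "T \<subseteq> X" "inj_on blk T" "blk ` T = {1..n} - blk ` Y"
  shows "F T = T \<union> Y" "inj_on blk (T \<union> Y)" "card (T \<union> Y) = n"
proof -
  show inj: "inj_on blk (T \<union> Y)"
    using assms by (auto simp: inj_on_Un)
  have "blk ` (T \<union> Y) = {1..n}"
    using assms(4) blk_X_Y by (auto simp: image_Un)
  then show card: "card (T \<union> Y) = n"
    using card_image[OF inj] by simp
  have "card T = n - card Y"
    using card_blk_complement assms card_image by metis
  then have "(n + 1) div 2 \<le> card T"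
    using card_Y by linarith
  then have "n \<le> card (F T)"
    using F_upper[OF assms(2)] inj assms(2) by (intro inj_F_card_ge) (auto intro: inj_on_subset)
  moreover have "finite (T \<union> Y)"
    using assms(2) finite_sub by simp
  ultimately show "F T = T \<union> Y"
    using card_seteq[of "T \<union> Y" "F T"] F_upper[OF assms(2)] card by simp
qed

lemma inj_Y_imp_inj_X:
  assumes "inj_on blk Y"
  shows "inj_on blk X"
proof (rule ccontr)
  assume "\<not> inj_on blk X"
  then obtain u v where uv: "u \<in> X" "v \<in> X" "blk u = blk v" "u \<noteq> v"
    by (auto simp: inj_on_def)
  \<comment> \<open>The points \<open>u\<close> and \<open>v\<close> of \<open>X\<close> exhaust
    their pair, and \<open>Y\<close> is disjoint from \<open>X\<close>.\<close>
  have u_Y: "blk u \<notin> blk ` Y"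
  proof
    assume "blk u \<in> blk ` Y"
    then obtain y where y: "y \<in> Y" "blk y = blk u"
      by auto
    have "blk v = blk y"
      using y(2) uv(3) by (rule trans[symmetric])
    then have "u = y \<or> v = y"
      using blk_three[OF uv(3)] uv(4) by blast
    then show False
      using y(1) uv(1,2) disjoint_X_Y by auto
  qed
  have u_range: "blk u \<in> {1..n}"
    using uv blk_X_Y by blast
  have "{1..n} - blk ` Y - {blk u} \<subseteq> blk ` X"
    using blk_X_Y by blast
  \<comment> \<open>Adding either \<open>u\<close> or \<open>v\<close> completes \<open>T\<close> to
    a transversal; the two images differ by one flip.\<close>
  then obtain T where T: "T \<subseteq> X" "inj_on blk T" "blk ` T = {1..n} - blk ` Y - {blk u}"
    using subset_image_inj by metis
  let ?S = "\<lambda>w. insert w T \<union> Y"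
  have S: "?S w \<in> R \<and> inj_on blk (?S w) \<and> card (?S w) = n"
    if "w \<in> X" "blk w = blk u" for w
  proof -
    have "insert w T \<subseteq> X" "inj_on blk (insert w T)" "blk ` insert w T = {1..n} - blk ` Y"
      using that T u_Y u_range by auto
    note tr = F_transversal[OF assms this]
    show ?thesis
      using tr F_in[OF \<open>insert w T \<subseteq> X\<close>] by simp
  qed
  have "v \<notin> ?S u"
    using uv T disjoint_X_Y by auto
  moreover have "?S u \<union> ?S v = insert v (?S u)"
    by auto
  moreover have "finite (?S u)"
    using T(1) finite_sub by simp
  ultimately have "card (?S u \<union> ?S v) = n + 1"
    using S[OF uv(1) refl] by simp
  from no_flip[OF _ _ this] show False
    using S[OF uv(1) refl] S[OF uv(2) uv(3)[symmetric]] by blast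
qed

lemma not_inj_Y: "\<not> inj_on blk Y"
proof
  assume "inj_on blk Y"
  then have inj: "inj_on blk X"
    by (rule inj_Y_imp_inj_X)
  have "card (blk ` Y) < card (blk ` X)"
    using card_blk_Y card_Y card_image[OF inj] card_X n4 by linarith
  then have "\<not> blk ` X \<subseteq> blk ` Y"
    using card_mono[of "blk ` Y" "blk ` X"] by auto
  then obtain i where i: "i \<in> X" "blk i \<notin> blk ` Y"
    by auto
  have "v = i" if "v \<in> X \<union> Y" "blk v = blk i" for v
    using that i inj by (metis UnE image_eqI inj_onD)
  with i(1) obtain z where z: "\<And>A. A \<subseteq> X - {i} \<Longrightarrow> F A \<subseteq> A \<union> (Y \<inter> {z})"
    by (rule lonely_point) auto
  \<comment> \<open>If \<open>z\<close> lies outside \<open>Y\<close>, any point of \<open>Y\<close>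
    serves; what matters is that \<open>y\<close> is in \<open>Y\<close>.\<close>
  obtain y where y: "y \<in> Y" "Y \<inter> {z} \<subseteq> {y}"
    using Y_nonempty by blast
  have "blk ` X = {1..n}"
    using blk_X_Y card_image[OF inj] by (intro card_subset_eq) (auto simp: card_X)
  then obtain w where w: "w \<in> X" "blk w = blk y"
    using y(1) blk_X_Y by (metis UnCI image_iff)
  then have "w \<noteq> i"
    using i(2) y(1) by auto
  \<comment> \<open>Besides \<open>i\<close>, the partner \<open>w\<close> of \<open>y\<close> is
    removed, so that \<open>y\<close> can join without forming a pair. The bound n - 2 \<ge> (n + 1)
    div 2 uses n \<ge> 4; it fails for n = 3.\<close>
  show False
  proof (rule lonely_point_contradiction)
    show "F (X - {i, w}) \<subseteq> (X - {i, w}) \<union> (Y \<inter> {y})"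
      using z[of "X - {i, w}"] y by blast
    show "inj_on blk (X - {i, w})"
      using inj by (rule inj_on_subset) auto
    show "blk y \<notin> blk ` (X - {i, w})"
      using inj w by (auto dest: inj_onD)
    have "card (X - {i, w}) = n - 2"
      using i(1) w(1) \<open>w \<noteq> i\<close> by (simp add: card_Diff_subset card_X)
    then show "(n + 1) div 2 \<le> card (X - {i, w})" "card (X - {i, w}) + 1 < n"
      using n4 by linarith+
  qed auto
qed

lemma contradiction: False
proof -
  let ?K = "blk ` Y"
  have card_K: "card ?K < card Y"
    using not_inj_Y card_blk_Y eq_card_imp_inj_on[of Y blk] by fastforce
  have "{1..n} - ?K \<subseteq> blk ` X"
    using blk_X_Y by blast
  then obtain T where T: "T \<subseteq> X" "inj_on blk T" "blk ` T = {1..n} - ?K"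
    using subset_image_inj by metis
  have finite_T: "finite T"
    using T(1) finite_sub by simp
  have card_T: "card T = n - card ?K"
    using card_blk_complement T card_image by metis
  \<comment> \<open>Counting: \<open>X - T\<close> has only \<open>card ?K\<close> points, fewer
    than \<open>T\<close>, so it cannot meet every pair met by \<open>T\<close>.\<close>
  obtain i where i: "i \<in> T" "blk i \<notin> blk ` (X - T)"
  proof (rule ccontr)
    assume "\<not> thesis"
    then have "blk ` T \<subseteq> blk ` (X - T)"
      using that by blast
    then have "card (blk ` T) \<le> card (X - T)"
      by (meson card_image_le card_mono finite_Diff finite_X finite_imageI le_trans)
    moreover have "card (blk ` T) = card T"
      using T(2) by (rule card_image)
    moreover have "card (X - T) = n - card T"
      using T(1) finite_T by (simp add: card_Diff_subset card_X)
    ultimately show False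
      using card_T card_K card_Y by linarith
  qed
  have "v = i" if "v \<in> X \<union> Y" "blk v = blk i" for v
  proof -
    have "v \<notin> Y"
      using that(2) i(1) T(3) by (metis DiffD2 imageI)
    moreover have "v \<notin> X - T"
      using that(2) i(2) by (metis imageI)
    ultimately show ?thesis
      using that i(1) T(2) by (metis DiffI UnE inj_onD)
  qed
  then obtain z where z: "\<And>A. A \<subseteq> X - {i} \<Longrightarrow> F A \<subseteq> A \<union> (Y \<inter> {z})"
    using i(1) T(1) by (metis lonely_point subsetD)
  obtain y where y: "y \<in> Y" "Y \<inter> {z} \<subseteq> {y}"
    using Y_nonempty by blast
  show False
  proof (rule lonely_point_contradiction)
    show "T - {i} \<subseteq> X"
      using T by auto
    show "F (T - {i}) \<subseteq> (T - {i}) \<union> (Y \<inter> {y})"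
      using z[of "T - {i}"] T y by blast
    show "inj_on blk (T - {i})"
      using T(2) by (auto intro: inj_on_subset)
    show "blk y \<notin> blk ` (T - {i})"
      using T(3) y(1) by blast
    \<comment> \<open>The strict inequality between \<open>card ?K\<close> and \<open>card Y\<close>
      pays for removing \<open>i\<close>; \<open>card ?K > 0\<close> leaves room for
      \<open>y\<close> below size n.\<close>
    have "card (T - {i}) = n - card ?K - 1"
      using i(1) card_T by simp
    moreover have "card ?K > 0"
      using Y_nonempty by (simp add: card_gt_0_iff)
    ultimately show "(n + 1) div 2 \<le> card (T - {i})" "card (T - {i}) + 1 < n"
      using card_K card_Y n4 by linarith+
  qed
qed

end

section \<open>From an embedding to a normalised copy\<close>

theorem theorem2:
  fixes n :: nat and R :: "nat set set"
  assumes "n \<ge> 4"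
    and "restrictive n R"
  shows "\<not> contains_copy n R"
proof
  assume "contains_copy n R"
  then obtain f where f: "poset_embedding n f" "f ` Pow {1..n} \<subseteq> R"
    by (auto simp: contains_copy_def)
  have f_iff: "S \<subseteq> T \<longleftrightarrow> f S \<subseteq> f T" if "S \<subseteq> {1..n}" "T \<subseteq> {1..n}" for S T
    using f(1) that by (auto simp: poset_embedding_def)
  have "\<exists>x. x \<in> f {i} \<and> x \<notin> f ({1..n} - {i})" if "i \<in> {1..n}" for i
    using f_iff[of "{i}" "{1..n} - {i}"] that by auto
  then obtain x where x: "\<And>i. i \<in> {1..n} \<Longrightarrow> x i \<in> f {i} \<and> x i \<notin> f ({1..n} - {i})"
    by metis
  \<comment> \<open>A set without \<open>i\<close> lies below \<open>{1..n} - {i}\<close>, and a set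
    with \<open>i\<close> lies above \<open>{i}\<close>.\<close>
  have x_iff: "x i \<in> f A \<longleftrightarrow> i \<in> A" if "i \<in> {1..n}" "A \<subseteq> {1..n}" for i A
  proof
    assume "x i \<in> f A"
    then show "i \<in> A"
      using x[OF that(1)] f_iff[of A "{1..n} - {i}"] that(2) by blast
  next
    assume "i \<in> A"
    then show "x i \<in> f A"
      using x[OF that(1)] f_iff[of "{i}" A] that by blast
  qed
  have inj_x: "inj_on x {1..n}"
  proof
    fix i j assume "i \<in> {1..n}" "j \<in> {1..n}" "x i = x j"
    then show "i = j"
      using x_iff[of i "{j}"] x_iff[of j "{j}"] by auto
  qed
  let ?X = "x ` {1..n}"
  \<comment> \<open>\<open>f\<close> transported along \<open>x\<close>: subsets of
    \<open>?X\<close> are read back as index sets.\<close>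
  define F where "F A = f {i \<in> {1..n}. x i \<in> A}" for A
  interpret restricted_lift n R ?X F
  proof
    show "?X \<subseteq> {1..2 * n}"
    proof
      fix v assume "v \<in> ?X"
      then obtain i where i: "i \<in> {1..n}" "v = x i"
        by auto
      then have "v \<in> f {i}" "{i} \<in> Pow {1..n}"
        using x by auto
      then show "v \<in> {1..2 * n}"
        using f(1) by (auto simp only: poset_embedding_def)
    qed
    show "card ?X = n"
      using inj_x by (simp add: card_image)
    show "F A \<in> R" for A
      unfolding F_def using f(2) by (rule subsetD) (intro imageI, blast)
    show "F A \<subseteq> F B" if "A \<subseteq> B" for A B
      unfolding F_def by (subst f_iff[symmetric]) (use that in blast)+
    show "F A \<inter> ?X = A" if "A \<subseteq> ?X" for A
    proof -
      have "x i \<in> F A \<longleftrightarrow> x i \<in> A" if "i \<in> {1..n}" for i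
        unfolding F_def using that by (subst x_iff) blast+
      then show ?thesis
        using that by blast
    qed
  qed (use assms in auto)
  show False
    by (rule contradiction)
qed

end
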